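(* Let $X\subseteq\mathbb{R}^n$ (not necessarily convex) and let $\psi$ be a continuous function. Suppose that the set of B-stationary values of the optimization problem $\min_{x\in X}\psi(x)$ is finite. If $\{x^k\}$ is a bounded sequence with the property that every one of its accumulation points is B-stationary for the problem, then the sequence of objective values $\{\psi(x^k)\}$ converges (to a B-stationary value) if and only if $\{\psi(x^{k+1})-\psi(x^k)\}\to0$.
   Context: The function $\psi$ is real-valued and directionally differentiable on an open set $\Omega\subseteq\mathbb{R}^n$ containing $X$, i.e. $\psi'(x;v)=\lim_{\delta\downarrow0}\frac{\psi(x+\delta v)-\psi(x)}{\delta}$ exists for all $(x,v)\in\Omega\times\mathbb{R}^n$; the sequence $\{x^k\}$ lies in $\Omega$. The Bouligand tangent cone $\mathcal{T}(x;X)$ of $X$ at $x\in X$ is the set of vectors $d\in\mathbb{R}^n$ for which there exist a sequence $\{z^k\}\subseteq X$ converging to $x$ and positive scalars $\tau_k\to0$ such that $d=\lim_{k\to\infty}(z^k-x)/\tau_k$. A vector $\bar x\in X$ is a B-stationary point of $\min_{x\in X}\psi(x)$ if $\psi'(\bar x;d)\ge0$ for all $d\in\mathcal{T}(\bar x;X)$; in this case $\psi(\bar x)$ is called a B-stationary value. Accumulation points are taken in $\mathbb{R}^n$; in particular all accumulation points of $\{x^k\}$ are assumed to belong to $X$, being B-stationary. *)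

theory Defs
  imports "HOL-Analysis.Analysis"
begin

text \<open>One-sided directional derivative. Since \<open>Lim\<close> is a total function, the value of \<open>dir_deriv\<close>
  is meaningful only where the limit exists, which is what \<open>dir_differentiable_on\<close> asserts.\<close>

definition dir_deriv :: "('a::real_normed_vector \<Rightarrow> real) \<Rightarrow> 'a \<Rightarrow> 'a \<Rightarrow> real" where
  "dir_deriv \<psi> x v = Lim (at_right 0) (\<lambda>\<delta>::real. (\<psi> (x + \<delta> *\<^sub>R v) - \<psi> x) / \<delta>)"

definition dir_differentiable_on :: "('a::real_normed_vector \<Rightarrow> real) \<Rightarrow> 'a set \<Rightarrow> bool" where
  "dir_differentiable_on \<psi> \<Omega> \<longleftrightarrow>
    (\<forall>x\<in>\<Omega>. \<forall>v. \<exists>L. ((\<lambda>\<delta>::real. (\<psi> (x + \<delta> *\<^sub>R v) - \<psi> x) / \<delta>) \<longlongrightarrow> L) (at_right 0))"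

definition tangent_cone :: "'a::real_normed_vector \<Rightarrow> 'a set \<Rightarrow> 'a set" where
  "tangent_cone x X =
    {d. \<exists>(z :: nat \<Rightarrow> 'a) (\<tau> :: nat \<Rightarrow> real).
          (\<forall>k. z k \<in> X) \<and> z \<longlonglongrightarrow> x \<and> (\<forall>k. \<tau> k > 0) \<and> \<tau> \<longlonglongrightarrow> 0 \<and>
          (\<lambda>k. (z k - x) /\<^sub>R \<tau> k) \<longlonglongrightarrow> d}"

definition B_stationary :: "('a::real_normed_vector \<Rightarrow> real) \<Rightarrow> 'a set \<Rightarrow> 'a \<Rightarrow> bool" where
  "B_stationary \<psi> X x \<longleftrightarrow> x \<in> X \<and> (\<forall>d\<in>tangent_cone x X. dir_deriv \<psi> x d \<ge> 0)"

definition B_stationary_values :: "('a::real_normed_vector \<Rightarrow> real) \<Rightarrow> 'a set \<Rightarrow> real set" where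
  "B_stationary_values \<psi> X = \<psi> ` {x. B_stationary \<psi> X x}"

text \<open>Accumulation points of a sequence are limits of subsequences, not limit points of its range:
  a value taken infinitely often is an accumulation point.\<close>

definition accumulation_point :: "(nat \<Rightarrow> 'a::topological_space) \<Rightarrow> 'a \<Rightarrow> bool" where
  "accumulation_point x p \<longleftrightarrow> (\<exists>r :: nat \<Rightarrow> nat. strict_mono r \<and> (x \<circ> r) \<longlonglongrightarrow> p)"

end

theory Submission
  imports Defs
begin

text \<open>By compactness and continuity, every subsequence of the values \<open>\<psi> (x k)\<close> has a further
  subsequence that converges to a B-stationary value, so the values cluster at a finite set \<open>S\<close> of
  reals (\<open>stationary_value_subsequence\<close>). For any sequence whose subsequences behave in this way, the
  distance to \<open>S\<close> tends to zero (\<open>eventually_near_cluster_set\<close>). The points of \<open>S\<close> lie at a positive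
  distance from each other, so once the sequence is close to \<open>S\<close> it can pass from the vicinity of
  one point of \<open>S\<close> to that of another only by a jump of a fixed positive size. If consecutive
  differences tend to zero, such jumps eventually cease, and the sequence is captured by a single
  point of \<open>S\<close> (\<open>finite_cluster_set_converges\<close>). The converse is immediate for every convergent
  sequence, and a limit of the values is also the limit of a subsequence that converges in \<open>S\<close>, hence
  a B-stationary value.\<close>

lemma finite_set_separation:
  fixes S :: "'a::metric_space set"
  assumes "finite S"
  obtains \<delta> where "\<delta> > 0" "\<And>a b. a \<in> S \<Longrightarrow> b \<in> S \<Longrightarrow> dist a b < \<delta> \<Longrightarrow> a = b"
proof -
  \<comment> \<open>The extra element 1 keeps the minimum meaningful when \<open>S\<close> has at most one point.\<close>
  define D where "D = insert 1 ((\<lambda>(a, b). dist a b) ` {(a, b) \<in> S \<times> S. a \<noteq> b})"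
  have "finite {(a, b) \<in> S \<times> S. a \<noteq> b}"
    by (rule finite_subset[of _ "S \<times> S"]) (use assms in auto)
  then have fin: "finite D" unfolding D_def by blast
  have "Min D \<in> D" by (rule Min_in) (use fin in \<open>auto simp: D_def\<close>)
  then have "Min D > 0" by (auto simp: D_def)
  moreover have "a = b" if "a \<in> S" "b \<in> S" "dist a b < Min D" for a b
  proof (rule ccontr)
    assume "a \<noteq> b"
    then have "dist a b \<in> D" using that by (force simp: D_def)
    then show False using Min_le[OF fin] that(3) by fastforce
  qed
  ultimately show ?thesis using that by blast
qed

text \<open>Otherwise the terms at distance at least \<open>e\<close> from every point of \<open>S\<close> would form a subsequence,
  none of whose subsequences could converge to a point of \<open>S\<close>.\<close>

lemma eventually_near_cluster_set:
  fixes y :: "nat \<Rightarrow> 'a::metric_space"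
  assumes cluster: "\<And>r :: nat \<Rightarrow> nat. strict_mono r \<Longrightarrow>
      \<exists>s\<in>S. \<exists>q :: nat \<Rightarrow> nat. strict_mono q \<and> (\<lambda>k. y (r (q k))) \<longlonglongrightarrow> s"
    and "e > 0"
  shows "\<forall>\<^sub>F k in sequentially. \<exists>s\<in>S. dist (y k) s < e"
proof (rule ccontr)
  define B where "B = {k. \<not> (\<exists>s\<in>S. dist (y k) s < e)}"
  assume "\<not> ?thesis"
  then have "infinite B"
    by (auto simp: B_def not_eventually frequently_sequentially infinite_nat_iff_unbounded_le)
  then obtain r :: "nat \<Rightarrow> nat" where r: "strict_mono r" "\<And>k. r k \<in> B"
    by (metis infinite_enumerate)
  obtain s q where s: "s \<in> S" and lim: "(\<lambda>k. y (r (q k))) \<longlonglongrightarrow> s"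
    using cluster[OF r(1)] by blast
  from tendstoD[OF lim \<open>e > 0\<close>] obtain k where "dist (y (r (q k))) s < e"
    by (auto simp: eventually_sequentially)
  then show False using r(2) s by (auto simp: B_def)
qed

text \<open>Let \<open>\<delta>\<close> separate the points of \<open>S\<close>. Within \<open>\<delta> / 3\<close> of \<open>S\<close>, a step shorter than \<open>\<delta> / 3\<close> cannot
  change the nearby point of \<open>S\<close>, since the old and the new one would be less than
  \<open>\<delta> / 3 + \<delta> / 3 + \<delta> / 3\<close> apart. The same separation shows that this point is also the one to which
  the sequence is close at every finer scale.\<close>

lemma finite_cluster_set_converges:
  fixes y :: "nat \<Rightarrow> 'a::metric_space"
  assumes "finite S"
    and near: "\<And>e. e > 0 \<Longrightarrow> \<forall>\<^sub>F k in sequentially. \<exists>s\<in>S. dist (y k) s < e"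
    and steps: "(\<lambda>k. dist (y (Suc k)) (y k)) \<longlonglongrightarrow> 0"
  shows "\<exists>s\<in>S. y \<longlonglongrightarrow> s"
proof -
  obtain \<delta> where \<delta>: "\<delta> > 0" "\<And>a b. a \<in> S \<Longrightarrow> b \<in> S \<Longrightarrow> dist a b < \<delta> \<Longrightarrow> a = b"
    using finite_set_separation[OF \<open>finite S\<close>] by blast
  have "\<delta> / 3 > 0" using \<delta>(1) by simp
  then have "\<forall>\<^sub>F k in sequentially. (\<exists>s\<in>S. dist (y k) s < \<delta> / 3) \<and> dist (y (Suc k)) (y k) < \<delta> / 3"
    by (intro eventually_conj near order_tendstoD(2)[OF steps])
  then obtain N where N: "\<And>k. k \<ge> N \<Longrightarrow> \<exists>s\<in>S. dist (y k) s < \<delta> / 3"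
      "\<And>k. k \<ge> N \<Longrightarrow> dist (y (Suc k)) (y k) < \<delta> / 3"
    by (auto simp: eventually_sequentially)
  obtain s where s: "s \<in> S" "dist (y N) s < \<delta> / 3" using N(1) by blast
  have captured: "dist (y k) s < \<delta> / 3" if "k \<ge> N" for k
    using that
  proof (induction k rule: dec_induct)
    case base
    show ?case by (rule s(2))
  next
    case (step k)
    obtain t where t: "t \<in> S" "dist (y (Suc k)) t < \<delta> / 3" using N(1)[of "Suc k"] step by auto
    have "dist t s \<le> dist (y (Suc k)) t + dist (y (Suc k)) (y k) + dist (y k) s"
      by metric
    also have "\<dots> < \<delta>" using t(2) N(2)[of k] step by linarith
    finally have "t = s" using \<delta>(2) t(1) s(1) by blast
    then show ?case using t(2) by simp
  qed
  have "y \<longlonglongrightarrow> s"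
  proof (rule tendstoI)
    fix e :: real
    assume "e > 0"
    have "\<forall>\<^sub>F k in sequentially. \<exists>t\<in>S. dist (y k) t < min e (\<delta> / 3)"
      by (rule near) (use \<open>e > 0\<close> \<delta>(1) in simp)
    then show "\<forall>\<^sub>F k in sequentially. dist (y k) s < e"
      using eventually_ge_at_top[of N]
    proof eventually_elim
      case (elim k)
      then obtain t where t: "t \<in> S" "dist (y k) t < min e (\<delta> / 3)" by blast
      have "dist t s < \<delta>"
        using dist_triangle3[of t s "y k"] t(2) captured[OF elim(2)] \<delta>(1) by linarith
      then have "t = s" using \<delta>(2) t(1) s(1) by blast
      then show ?case using t(2) by simp
    qed
  qed
  then show ?thesis using s(1) by blast
qed

text \<open>The domain is open, so \<open>\<psi>\<close> is continuous at the accumulation point supplied by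
  Bolzano-Weierstrass and carries the convergence of the points over to the values.\<close>

lemma stationary_value_subsequence:
  fixes x :: "nat \<Rightarrow> 'a::euclidean_space"
  assumes "open \<Omega>" "X \<subseteq> \<Omega>" "continuous_on \<Omega> \<psi>" "bounded (range x)"
    and stationary: "\<And>p. accumulation_point x p \<Longrightarrow> B_stationary \<psi> X p"
    and "strict_mono (r :: nat \<Rightarrow> nat)"
  shows "\<exists>s\<in>B_stationary_values \<psi> X. \<exists>q :: nat \<Rightarrow> nat. strict_mono q \<and> (\<lambda>k. \<psi> (x (r (q k)))) \<longlonglongrightarrow> s"
proof -
  have "bounded (range (x \<circ> r))"
    by (rule bounded_subset[OF \<open>bounded (range x)\<close>]) auto
  then obtain p q where q: "strict_mono (q :: nat \<Rightarrow> nat)" and lim: "((x \<circ> r) \<circ> q) \<longlonglongrightarrow> p"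
    using bounded_imp_convergent_subsequence by blast
  have "accumulation_point x p"
    unfolding accumulation_point_def
    using strict_mono_o[OF \<open>strict_mono r\<close> q] lim by (auto simp: o_assoc)
  then have p: "B_stationary \<psi> X p" by (rule stationary)
  then have "p \<in> \<Omega>" using \<open>X \<subseteq> \<Omega>\<close> by (auto simp: B_stationary_def)
  then have "isCont \<psi> p" using assms(1,3) by (simp add: continuous_on_eq_continuous_at)
  then have "(\<lambda>k. \<psi> (x (r (q k)))) \<longlonglongrightarrow> \<psi> p"
    using isCont_tendsto_compose[OF _ lim] by (simp add: o_def)
  then show ?thesis using p q by (auto simp: B_stationary_values_def)
qed

theorem proposition14:
  fixes X \<Omega> :: "(real ^ 'n) set"
    and \<psi> :: "real ^ 'n \<Rightarrow> real"
    and x :: "nat \<Rightarrow> real ^ 'n"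
  assumes "open \<Omega>" and "X \<subseteq> \<Omega>"
    and "dir_differentiable_on \<psi> \<Omega>"
    and "continuous_on \<Omega> \<psi>"
    and "finite (B_stationary_values \<psi> X)"
    and "\<And>k. x k \<in> \<Omega>"
    and "bounded (range x)"
    and "\<And>p. accumulation_point x p \<Longrightarrow> B_stationary \<psi> X p"
  shows "(convergent (\<lambda>k. \<psi> (x k)) \<longleftrightarrow> (\<lambda>k. \<psi> (x (Suc k)) - \<psi> (x k)) \<longlonglongrightarrow> 0) \<and>
         (\<forall>L. (\<lambda>k. \<psi> (x k)) \<longlonglongrightarrow> L \<longrightarrow> L \<in> B_stationary_values \<psi> X)"
proof -
  let ?y = "\<lambda>k. \<psi> (x k)" and ?S = "B_stationary_values \<psi> X"
  have cluster: "\<exists>s\<in>?S. \<exists>q :: nat \<Rightarrow> nat. strict_mono q \<and> (\<lambda>k. ?y (r (q k))) \<longlonglongrightarrow> s"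
    if "strict_mono r" for r :: "nat \<Rightarrow> nat"
    using assms(1,2,4,7,8) that by (rule stationary_value_subsequence)
  have "(\<lambda>k. ?y (Suc k) - ?y k) \<longlonglongrightarrow> 0" if conv: "convergent ?y"
  proof -
    obtain L where L: "?y \<longlonglongrightarrow> L" using conv by (auto simp: convergent_def)
    show ?thesis using tendsto_diff[OF LIMSEQ_Suc[OF L] L] by simp
  qed
  moreover have "convergent ?y" if "(\<lambda>k. ?y (Suc k) - ?y k) \<longlonglongrightarrow> 0"
  proof -
    have "(\<lambda>k. dist (?y (Suc k)) (?y k)) \<longlonglongrightarrow> 0"
      using that by (simp add: dist_real_def tendsto_rabs_zero_iff)
    then have "\<exists>s\<in>?S. ?y \<longlonglongrightarrow> s"
      using assms(5) eventually_near_cluster_set[of ?S ?y, OF cluster]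
      by (intro finite_cluster_set_converges) auto
    then show ?thesis by (auto simp: convergent_def)
  qed
  moreover have "L \<in> ?S" if L: "?y \<longlonglongrightarrow> L" for L
  proof -
    obtain s q where s: "s \<in> ?S" and q: "strict_mono q" "(\<lambda>k. ?y (q k)) \<longlonglongrightarrow> s"
      using cluster[of id] by (auto simp: strict_mono_id)
    have "(\<lambda>k. ?y (q k)) \<longlonglongrightarrow> L" using LIMSEQ_subseq_LIMSEQ[OF L q(1)] by (simp add: o_def)
    then show ?thesis using q(2) s LIMSEQ_unique by blast
  qed
  ultimately show ?thesis by blast
qed

end
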